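(* Let $\mathbb{K}$ be a field and let $\mathbb{K}\{\{t\}\}$ be the field of Puiseux series over $\mathbb{K}$. Given two coaxial points $p_1=(-u,-v)$ and $p_2=(-u',-v')$ in $\mathbb{Q}^2$, pick lifts $P_1=(a_1t^{u}+\cdots,\ b_1t^{v}+\cdots)$ and $P_2=(a_2t^{u'}+\cdots,\ b_2t^{v}+\cdots)$ over $\mathbb{K}\{\{t\}\}$. If $b_1\neq b_2$, then $\mathrm{trop}(P_1P_2)$, the tropicalization of the line $P_1P_2$ through $P_1$ and $P_2$, is the stable tropical line through $p_1$ and $p_2$.
   Context: The valuation on $\mathbb{K}\{\{t\}\}$ sends a nonzero series to its lowest exponent. In the expressions for $P_1,P_2$, the coefficients $a_i,b_i\in\mathbb{K}$ are the leading coefficients and the dots denote terms of higher order in $t$. A lift of a point $p\in\mathbb{Q}^2$ is a point of $\mathbb{K}\{\{t\}\}^2$ with nonzero coordinates which is mapped to $p$ by taking minus the valuation of each coordinate. The tropicalization (max convention) of a polynomial $f=\sum_{w} c_w x^w$ over $\mathbb{K}\{\{t\}\}$ is $\mathrm{trop}(f)(z)=\max\{-\mathrm{val}(c_w)+z\cdot w : c_w\neq 0\}$. For a line in the plane with equation $f=0$, its tropicalization is the locus in $\mathbb{R}^2$ where the maximum in $\mathrm{trop}(f)$ is attained at least twice. The tropical line with vertex $p\in\mathbb{R}^2$ is the union of the three closed rays emanating from $p$ in the directions $(-1,0)$, $(0,-1)$, $(1,1)$. Two points are coaxial if they lie on the same ray of a tropical line containing them. A tropical line $L$ containing two points $p_1,p_2$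 is a stable tropical line through $p_1,p_2$ if either $L$ is the unique tropical line through $p_1$ and $p_2$, or one of $p_1,p_2$ is the vertex of $L$. *)

theory Defs
  imports
    "HOL-Analysis.Analysis"
    "HOL-Computational_Algebra.Formal_Laurent_Series"
    "HOL-Library.Poly_Mapping"
begin

section \<open>The field of Puiseux series\<close>

text \<open>
  A Puiseux series is a formal Laurent series in \<open>t\<^bsup>1/n\<^esup>\<close> for some \<open>n \<ge> 1\<close>. It is represented by
  its coefficient function on rational exponents, so that the union over all \<open>n\<close> needs no quotient.
\<close>

definition puiseux_funs :: "(rat \<Rightarrow> 'a::zero) set" where
  "puiseux_funs = {f. \<exists>n::nat. n > 0 \<and> (\<exists>m::int. \<forall>q. f q \<noteq> 0 \<longrightarrow>
      (\<exists>k::int. k \<ge> m \<and> q = of_int k / of_nat n))}"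

typedef (overloaded) 'a puiseux = "puiseux_funs :: (rat \<Rightarrow> 'a::zero) set"
  morphisms puiseux_nth Abs_puiseux
proof
  show "(\<lambda>_. 0) \<in> puiseux_funs"
    by (auto simp: puiseux_funs_def)
qed

setup_lifting type_definition_puiseux

lemma puiseux_eqI: "(\<And>q. puiseux_nth f q = puiseux_nth g q) \<Longrightarrow> f = g"
  by (metis puiseux_nth_inject ext)

text \<open>
  The Puiseux series obtained by substituting \<open>t\<^bsup>1/n\<^esup>\<close> into a Laurent series. The field axioms are
  transferred along these maps.
\<close>

definition root_subst :: "nat \<Rightarrow> 'a::zero fls \<Rightarrow> rat \<Rightarrow> 'a" where
  "root_subst n F q = (if q * of_nat n \<in> \<int> then fls_nth F \<lfloor>q * of_nat n\<rfloor> else 0)"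

lemma root_subst_nth:
  "n > 0 \<Longrightarrow> root_subst n F (of_int k / of_nat n) = fls_nth F k"
  by (simp add: root_subst_def)

lemma root_subst_nonzeroE:
  assumes "n > 0" "root_subst n F q \<noteq> 0"
  obtains k where "q = of_int k / of_nat n" "fls_nth F k \<noteq> 0"
proof -
  from assms obtain k where "q * of_nat n = of_int k" "fls_nth F k \<noteq> 0"
    by (auto simp: root_subst_def elim!: Ints_cases split: if_splits)
  with assms show ?thesis
    by (intro that[of k]) (auto simp: field_simps)
qed

lemma root_subst_in_puiseux_funs:
  assumes "n > 0"
  shows "root_subst n F \<in> puiseux_funs"
proof -
  have "\<exists>k\<ge>fls_subdegree F. q = of_int k / of_nat n" if "root_subst n F q \<noteq> 0" for q
    using root_subst_nonzeroE[OF assms that] fls_subdegree_leI by metis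
  with assms show ?thesis
    unfolding puiseux_funs_def by blast
qed

lemma root_subst_inj:
  assumes "n > 0" "root_subst n F = root_subst n G"
  shows "F = G"
  using assms root_subst_nth by (metis fls_eqI)

lemma puiseux_funs_root_subst:
  assumes "f \<in> puiseux_funs"
  obtains n :: nat where "n > 0" "\<And>k. k > 0 \<Longrightarrow> \<exists>F. f = root_subst (n * k) F"
proof -
  from assms obtain n :: nat and m :: int where n: "n > 0"
    and f: "\<And>q. f q \<noteq> 0 \<Longrightarrow> \<exists>k::int. k \<ge> m \<and> q = of_int k / of_nat n"
    unfolding puiseux_funs_def by blast
  have "\<exists>F. f = root_subst (n * k) F" if "k > 0" for k
  proof -
    let ?N = "n * k"
    define F where "F = Abs_fls (\<lambda>i::int. f (of_int i / of_nat ?N))"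
    have N: "?N > 0"
      using n that by simp
    have supp: "\<exists>i::int. i \<ge> m * int k \<and> q = of_int i / of_nat ?N" if "f q \<noteq> 0" for q
    proof -
      from f[OF that] obtain j where "j \<ge> m" "q = of_int j / of_nat n"
        by blast
      with n \<open>k > 0\<close> show ?thesis
        by (intro exI[of _ "j * int k"]) (auto simp: mult_right_mono)
    qed
    have "f (of_int i / of_nat ?N) = 0" if "i < m * int k" for i
    proof (rule ccontr)
      assume "f (of_int i / of_nat ?N) \<noteq> 0"
      from supp[OF this] obtain j where j: "j \<ge> m * int k"
        "(of_int i / of_nat ?N :: rat) = of_int j / of_nat ?N"
        by blast
      have "(of_nat ?N :: rat) \<noteq> 0"
        using N by (simp only: of_nat_eq_0_iff)
      with j(2) have "(of_int i :: rat) = of_int j"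
        by (metis nonzero_eq_divide_eq)
      with j(1) that show False
        by simp
    qed
    then have F: "fls_nth F i = f (of_int i / of_nat ?N)" for i
      unfolding F_def by (subst nth_Abs_fls_lower_bound[of "m * int k"]) auto
    have "f q = root_subst ?N F q" for q
    proof (cases "q * of_nat ?N \<in> \<int>")
      case True
      then obtain i where i: "q * of_nat ?N = of_int i"
        by (elim Ints_cases)
      have "(of_nat ?N :: rat) \<noteq> 0"
        using N by (simp only: of_nat_eq_0_iff)
      with i have "q = of_int i / of_nat ?N"
        by (metis nonzero_mult_div_cancel_right)
      then show ?thesis
        using root_subst_nth[OF N, of F i] F by simp
    next
      case False
      have "f q = 0"
      proof (rule ccontr)
        assume "f q \<noteq> 0"
        from supp[OF this] obtain i :: int where "q = of_int i / of_nat ?N"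
          by blast
        with N have "q * of_nat ?N = of_int i"
          by simp
        with False show False
          by (metis Ints_of_int)
      qed
      with False show ?thesis
        by (simp add: root_subst_def)
    qed
    then show ?thesis
      by blast
  qed
  with n show ?thesis
    by (intro that) auto
qed

lemma puiseux_funs_root_subst2:
  assumes "f \<in> puiseux_funs" "g \<in> puiseux_funs"
  obtains n F G where "n > 0" "f = root_subst n F" "g = root_subst n G"
proof -
  obtain n1 where n1: "n1 > 0" "\<And>k. k > 0 \<Longrightarrow> \<exists>F. f = root_subst (n1 * k) F"
    using puiseux_funs_root_subst[OF assms(1)] by metis
  obtain n2 where n2: "n2 > 0" "\<And>k. k > 0 \<Longrightarrow> \<exists>F. g = root_subst (n2 * k) F"
    using puiseux_funs_root_subst[OF assms(2)] by metis
  from n1(2)[of n2] n2(2)[of n1] n1(1) n2(1) show ?thesis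
    using that[of "n1 * n2"] by (auto simp: mult.commute)
qed

lemma puiseux_funs_root_subst3:
  assumes "f \<in> puiseux_funs" "g \<in> puiseux_funs" "h \<in> puiseux_funs"
  obtains n F G H where "n > 0" "f = root_subst n F" "g = root_subst n G" "h = root_subst n H"
proof -
  obtain n1 where n1: "n1 > 0" "\<And>k. k > 0 \<Longrightarrow> \<exists>F. f = root_subst (n1 * k) F"
    using puiseux_funs_root_subst[OF assms(1)] by metis
  obtain n2 where n2: "n2 > 0" "\<And>k. k > 0 \<Longrightarrow> \<exists>F. g = root_subst (n2 * k) F"
    using puiseux_funs_root_subst[OF assms(2)] by metis
  obtain n3 where n3: "n3 > 0" "\<And>k. k > 0 \<Longrightarrow> \<exists>F. h = root_subst (n3 * k) F"
    using puiseux_funs_root_subst[OF assms(3)] by metis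
  have "n2 * (n1 * n3) = n1 * (n2 * n3)" "n3 * (n1 * n2) = n1 * (n2 * n3)"
    by simp_all
  with n1(2)[of "n2 * n3"] n2(2)[of "n1 * n3"] n3(2)[of "n1 * n2"] n1(1) n2(1) n3(1)
  show ?thesis
    using that[of "n1 * (n2 * n3)"] by auto
qed

definition puiseux_conv :: "(rat \<Rightarrow> 'a::comm_ring_1) \<Rightarrow> (rat \<Rightarrow> 'a) \<Rightarrow> rat \<Rightarrow> 'a" where
  "puiseux_conv f g q = (\<Sum>r | f r \<noteq> 0 \<and> g (q - r) \<noteq> 0. f r * g (q - r))"

lemma root_subst_zero: "root_subst n 0 = (\<lambda>_. 0)"
  by (rule ext) (simp add: root_subst_def)

lemma root_subst_one:
  assumes "n > 0"
  shows "root_subst n 1 = (\<lambda>q. if q = 0 then 1 else 0 :: 'a::{zero,one})"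
  using assms by (intro ext) (auto simp: root_subst_def elim!: Ints_cases)

lemma root_subst_add:
  "root_subst n (F + G) = (\<lambda>q. root_subst n F q + root_subst n G q :: 'a::group_add)"
  by (rule ext) (simp add: root_subst_def)

lemma root_subst_uminus:
  "root_subst n (- F) = (\<lambda>q. - root_subst n F q :: 'a::group_add)"
  by (rule ext) (simp add: root_subst_def)

lemma root_subst_diff:
  "root_subst n (F - G) = (\<lambda>q. root_subst n F q - root_subst n G q :: 'a::group_add)"
  by (rule ext) (simp add: root_subst_def)

lemma root_subst_times:
  fixes F G :: "'a::comm_ring_1 fls"
  assumes n: "n > 0"
  shows "root_subst n (F * G) = puiseux_conv (root_subst n F) (root_subst n G)"
proof
  fix q
  let ?f = "root_subst n F" and ?g = "root_subst n G"
  let ?S = "{r. ?f r \<noteq> 0 \<and> ?g (q - r) \<noteq> 0}"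
  show "root_subst n (F * G) q = puiseux_conv ?f ?g q"
  proof (cases "q * of_nat n \<in> \<int>")
    case True
    then obtain k where "q * of_nat n = of_int k"
      by (elim Ints_cases)
    with n have q: "q = of_int k / of_nat n"
      by (auto simp: field_simps)
    let ?T = "{i. fls_nth F i \<noteq> 0 \<and> fls_nth G (k - i) \<noteq> 0}"
    have qi: "q - of_int i / of_nat n = of_int (k - i) / of_nat n" for i
      by (simp add: q diff_divide_distrib)
    have inj: "inj_on (\<lambda>i::int. of_int i / of_nat n :: rat) ?T"
      using n by (intro inj_onI) simp
    have S: "?S = (\<lambda>i. of_int i / of_nat n) ` ?T"
    proof (intro equalityI subsetI)
      fix r assume r: "r \<in> ?S"
      then obtain i where i: "r = of_int i / of_nat n" "fls_nth F i \<noteq> 0"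
        using root_subst_nonzeroE[OF n, of F r] by auto
      have "fls_nth G (k - i) \<noteq> 0"
        using r i(1) root_subst_nth[OF n, of G "k - i"] by (simp only: qi mem_Collect_eq) simp
      with i show "r \<in> (\<lambda>i. of_int i / of_nat n) ` ?T"
        by blast
    next
      fix r :: rat assume "r \<in> (\<lambda>i. of_int i / of_nat n) ` ?T"
      then show "r \<in> ?S"
        by (auto simp only: qi root_subst_nth[OF n] mem_Collect_eq image_iff)
    qed
    have "puiseux_conv ?f ?g q = (\<Sum>i\<in>?T. fls_nth F i * fls_nth G (k - i))"
      unfolding puiseux_conv_def S
      by (subst sum.reindex[OF inj]) (simp only: o_def qi root_subst_nth[OF n])
    also have "\<dots> = (\<Sum>i=fls_subdegree F..k - fls_subdegree G. fls_nth F i * fls_nth G (k - i))"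
    proof (rule sum.mono_neutral_left)
      show "?T \<subseteq> {fls_subdegree F..k - fls_subdegree G}"
      proof
        fix i assume "i \<in> ?T"
        then have "fls_subdegree F \<le> i" "fls_subdegree G \<le> k - i"
          using fls_subdegree_leI by blast+
        then show "i \<in> {fls_subdegree F..k - fls_subdegree G}"
          by simp
      qed
    qed auto
    also have "\<dots> = fls_nth (F * G) k"
      by (simp add: fls_times_nth(2))
    also have "\<dots> = root_subst n (F * G) q"
      by (simp add: q root_subst_nth[OF n])
    finally show ?thesis ..
  next
    case False
    have "?S = {}"
    proof (rule ccontr)
      assume "?S \<noteq> {}"
      then obtain r where r: "?f r \<noteq> 0" "?g (q - r) \<noteq> 0"
        by blast
      obtain i where i: "r = of_int i / of_nat n"
        using root_subst_nonzeroE[OF n r(1)] by blast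
      obtain j where j: "q - r = of_int j / of_nat n"
        using root_subst_nonzeroE[OF n r(2)] by blast
      have "q = of_int (i + j) / of_nat n"
        using i j by (simp add: add_divide_distrib algebra_simps)
      with n have "q * of_nat n = of_int (i + j)"
        by simp
      with False show False
        by (metis Ints_of_int)
    qed
    then have "puiseux_conv ?f ?g q = 0"
      by (simp only: puiseux_conv_def sum.empty)
    with False show ?thesis
      by (simp add: root_subst_def)
  qed
qed

instantiation puiseux :: (field) field
begin

lift_definition zero_puiseux :: "'a puiseux" is "\<lambda>_. 0"
  by (auto simp: puiseux_funs_def)

lift_definition one_puiseux :: "'a puiseux" is "\<lambda>q. if q = 0 then 1 else 0"
  by (subst root_subst_one[of 1, symmetric]) (simp_all add: root_subst_in_puiseux_funs)

lift_definition plus_puiseux :: "'a puiseux \<Rightarrow> 'a puiseux \<Rightarrow> 'a puiseux"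
  is "\<lambda>f g q. f q + g q"
  by (erule (1) puiseux_funs_root_subst2)
     (simp add: root_subst_add[symmetric] root_subst_in_puiseux_funs)

lift_definition uminus_puiseux :: "'a puiseux \<Rightarrow> 'a puiseux" is "\<lambda>f q. - f q"
  by (simp add: puiseux_funs_def)

lift_definition minus_puiseux :: "'a puiseux \<Rightarrow> 'a puiseux \<Rightarrow> 'a puiseux"
  is "\<lambda>f g q. f q - g q"
  by (erule (1) puiseux_funs_root_subst2)
     (simp add: root_subst_diff[symmetric] root_subst_in_puiseux_funs)

lift_definition times_puiseux :: "'a puiseux \<Rightarrow> 'a puiseux \<Rightarrow> 'a puiseux"
  is puiseux_conv
  by (erule (1) puiseux_funs_root_subst2)
     (simp add: root_subst_times[symmetric] root_subst_in_puiseux_funs)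

definition inverse_puiseux :: "'a puiseux \<Rightarrow> 'a puiseux" where
  "inverse_puiseux f = (if f = 0 then 0 else THE g. f * g = 1)"

definition divide_puiseux :: "'a puiseux \<Rightarrow> 'a puiseux \<Rightarrow> 'a puiseux" where
  "divide_puiseux f g = f * inverse g"

instance
proof
  fix a b c :: "'a puiseux"
  show assoc: "a * b * c = a * (b * c)" for a b c :: "'a puiseux"
    by transfer (erule (2) puiseux_funs_root_subst3,
      simp add: root_subst_times[symmetric] mult.assoc)
  show comm: "a * b = b * a" for a b :: "'a puiseux"
    by transfer (erule (1) puiseux_funs_root_subst2,
      simp add: root_subst_times[symmetric] mult.commute)
  show one: "1 * a = a" for a :: "'a puiseux"
  proof -
    obtain n F where n: "n > 0" and F: "puiseux_nth a = root_subst n F"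
      using puiseux_funs_root_subst2[OF puiseux_nth puiseux_nth] by metis
    have "puiseux_nth (1 * a) = puiseux_conv (root_subst n 1) (root_subst n F)"
      by (simp only: times_puiseux.rep_eq one_puiseux.rep_eq root_subst_one[OF n] F)
    also have "\<dots> = puiseux_nth a"
      by (simp only: root_subst_times[OF n, symmetric] mult_1_left F)
    finally show ?thesis
      by (simp only: puiseux_nth_inject)
  qed
  show "a + b + c = a + (b + c)"
    by transfer (simp add: add.assoc)
  show "a + b = b + a"
    by transfer (simp add: add.commute)
  show "0 + a = a"
    by transfer simp
  show "- a + a = 0"
    by transfer simp
  show "a - b = a + - b"
    by transfer simp
  show "(a + b) * c = a * c + b * c"
    by transfer (erule (2) puiseux_funs_root_subst3,
      simp add: root_subst_times[symmetric] root_subst_add[symmetric] distrib_right)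
  show "(0::'a puiseux) \<noteq> 1"
  proof
    assume "(0::'a puiseux) = 1"
    then have "puiseux_nth (0::'a puiseux) 0 = puiseux_nth 1 0"
      by simp
    then show False
      by (simp add: zero_puiseux.rep_eq one_puiseux.rep_eq)
  qed
  show "inverse (0::'a puiseux) = 0"
    by (simp add: inverse_puiseux_def)
  show "a div b = a * inverse b"
    by (simp add: divide_puiseux_def)
  show "inverse a * a = 1" if "a \<noteq> 0"
  proof -
    have "\<exists>g. a * g = 1"
    proof -
      obtain n F where n: "n > 0" and F: "puiseux_nth a = root_subst n F"
        using puiseux_funs_root_subst2[OF puiseux_nth puiseux_nth] by metis
      have "F \<noteq> 0"
      proof
        assume "F = 0"
        with F have "puiseux_nth a q = puiseux_nth 0 q" for q
          by (simp add: root_subst_zero zero_puiseux.rep_eq)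
        with that show False
          using puiseux_eqI by blast
      qed
      then have "F * inverse F = 1"
        by simp
      then have "puiseux_nth (a * Abs_puiseux (root_subst n (inverse F))) = root_subst n 1"
        by (simp only: times_puiseux.rep_eq F Abs_puiseux_inverse[OF root_subst_in_puiseux_funs[OF n]]
            root_subst_times[OF n, symmetric])
      also have "\<dots> = puiseux_nth 1"
        by (simp only: one_puiseux.rep_eq root_subst_one[OF n])
      finally have "a * Abs_puiseux (root_subst n (inverse F)) = 1"
        by (simp only: puiseux_nth_inject)
      then show ?thesis
        by blast
    qed
    then obtain g where g: "a * g = 1"
      by blast
    have "h = g" if "a * h = 1" for h
      by (metis assoc comm one g that)
    with g have "(THE g. a * g = 1) = g"
      by (rule the_equality)
    then have "inverse a = g"
      using \<open>a \<noteq> 0\<close> by (simp only: inverse_puiseux_def if_False)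
    with g show ?thesis
      by (simp only: comm[of g a])
  qed
qed

end

text \<open>Meaningful for nonzero series only, cf. \<open>puiseux_val\<close>.\<close>

definition pval :: "'a::zero puiseux \<Rightarrow> rat" where
  "pval f = (LEAST q. puiseux_nth f q \<noteq> 0)"

lemma pval_root_subst:
  assumes n: "n > 0" and F: "puiseux_nth f = root_subst n F" and "F \<noteq> 0"
  shows "puiseux_nth f (pval f) \<noteq> 0"
    and "puiseux_nth f q \<noteq> 0 \<Longrightarrow> pval f \<le> q"
    and "pval f = of_int (fls_subdegree F) / of_nat n"
proof -
  define v :: rat where "v = of_int (fls_subdegree F) / of_nat n"
  have v: "puiseux_nth f v \<noteq> 0"
    using \<open>F \<noteq> 0\<close> by (simp add: F v_def root_subst_nth[OF n])
  have le: "v \<le> q" if q: "puiseux_nth f q \<noteq> 0" for q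
  proof -
    obtain k where k: "q = of_int k / of_nat n" "fls_nth F k \<noteq> 0"
      using root_subst_nonzeroE[OF n, of F q] q F by metis
    then have "fls_subdegree F \<le> k"
      by (simp add: fls_subdegree_leI)
    with k(1) show ?thesis
      by (simp add: v_def divide_right_mono)
  qed
  have "pval f = v"
    unfolding pval_def using v le by (intro Least_equality)
  then show "puiseux_nth f (pval f) \<noteq> 0" "pval f = of_int (fls_subdegree F) / of_nat n"
    using v by (simp_all add: v_def)
  show "pval f \<le> q" if "puiseux_nth f q \<noteq> 0"
    using \<open>pval f = v\<close> le[OF that] by simp
qed

lemma root_subst_nonzero:
  assumes "f \<noteq> 0" "puiseux_nth f = root_subst n F"
  shows "F \<noteq> 0"
proof
  assume "F = 0"
  with assms(2) have "puiseux_nth f q = puiseux_nth 0 q" for q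
    by (simp add: root_subst_zero zero_puiseux.rep_eq)
  with assms(1) show False
    using puiseux_eqI by blast
qed

lemma puiseux_val:
  fixes f :: "'a::field puiseux"
  assumes "f \<noteq> 0"
  shows "puiseux_nth f (pval f) \<noteq> 0"
    and "puiseux_nth f q \<noteq> 0 \<Longrightarrow> pval f \<le> q"
proof -
  obtain n F where n: "n > 0" and F: "puiseux_nth f = root_subst n F"
    using puiseux_funs_root_subst2[OF puiseux_nth puiseux_nth] by metis
  show "puiseux_nth f (pval f) \<noteq> 0" "puiseux_nth f q \<noteq> 0 \<Longrightarrow> pval f \<le> q"
    using pval_root_subst[OF n F root_subst_nonzero[OF assms F]] by auto
qed

lemma pval_mult:
  fixes f g :: "'a::field puiseux"
  assumes "f \<noteq> 0" "g \<noteq> 0"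
  shows "pval (f * g) = pval f + pval g"
proof -
  obtain n F G where n: "n > 0"
    and F: "puiseux_nth f = root_subst n F" and G: "puiseux_nth g = root_subst n G"
    using puiseux_funs_root_subst2[OF puiseux_nth puiseux_nth] by metis
  have FG: "puiseux_nth (f * g) = root_subst n (F * G)"
    by (simp add: times_puiseux.rep_eq F G root_subst_times[OF n])
  have nz: "F \<noteq> 0" "G \<noteq> 0"
    using root_subst_nonzero assms F G by blast+
  then have "F * G \<noteq> 0"
    by simp
  then show ?thesis
    using pval_root_subst(3)[OF n FG] pval_root_subst(3)[OF n F] pval_root_subst(3)[OF n G] nz
    by (simp add: add_divide_distrib)
qed

text \<open>\<open>f = a t\<^bsup>q\<^esup> + \<cdots>\<close> where the dots are terms of order higher than \<open>q\<close>.\<close>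

definition has_leading_term :: "'a::zero puiseux \<Rightarrow> 'a \<Rightarrow> rat \<Rightarrow> bool" where
  "has_leading_term f a q \<longleftrightarrow> a \<noteq> 0 \<and> puiseux_nth f q = a \<and> (\<forall>r<q. puiseux_nth f r = 0)"


section \<open>Polynomials in two variables, lines and tropicalization\<close>

text \<open>
  A polynomial \<open>\<Sum>\<^sub>w c\<^sub>w x\<^bsup>w\<^esup>\<close> in two variables is the finitely supported map \<open>w \<mapsto> c\<^sub>w\<close>.
\<close>

type_synonym 'k poly2 = "(nat \<times> nat) \<Rightarrow>\<^sub>0 'k"

definition poly2_eval :: "'k::comm_ring_1 poly2 \<Rightarrow> 'k \<times> 'k \<Rightarrow> 'k" where
  "poly2_eval f X =
     (\<Sum>w\<in>Poly_Mapping.keys f. Poly_Mapping.lookup f w * fst X ^ fst w * snd X ^ snd w)"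

definition line_through :: "'k::field \<times> 'k \<Rightarrow> 'k \<times> 'k \<Rightarrow> ('k \<times> 'k) set" where
  "line_through P Q = {(fst P + s * (fst Q - fst P), snd P + s * (snd Q - snd P)) | s. True}"

definition line_equation :: "'k::field poly2 \<Rightarrow> ('k \<times> 'k) set \<Rightarrow> bool" where
  "line_equation f l \<longleftrightarrow>
     (\<forall>w\<in>Poly_Mapping.keys f. fst w + snd w \<le> 1) \<and>
     (\<exists>w\<in>Poly_Mapping.keys f. fst w + snd w = 1) \<and>
     l = {X. poly2_eval f X = 0}"

definition trop_term :: "'a::field puiseux poly2 \<Rightarrow> nat \<times> nat \<Rightarrow> real \<times> real \<Rightarrow> real" where
  "trop_term f w z = - of_rat (pval (Poly_Mapping.lookup f w))
                       + (fst z * of_nat (fst w) + snd z * of_nat (snd w))"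

definition trop :: "'a::field puiseux poly2 \<Rightarrow> real \<times> real \<Rightarrow> real" where
  "trop f z = Max {trop_term f w z | w. Poly_Mapping.lookup f w \<noteq> 0}"

definition trop_locus :: "'a::field puiseux poly2 \<Rightarrow> (real \<times> real) set" where
  "trop_locus f = {z. \<exists>w w'. w \<noteq> w' \<and>
      Poly_Mapping.lookup f w \<noteq> 0 \<and> Poly_Mapping.lookup f w' \<noteq> 0 \<and>
      trop_term f w z = trop f z \<and> trop_term f w' z = trop f z}"

text \<open>The choice of the equation is immaterial, cf. \<open>trop_line_eq\<close>; for distinct points there is one,
  cf. \<open>line_equation_exists\<close>.\<close>

definition trop_line :: "('a::field puiseux \<times> 'a puiseux) set \<Rightarrow> (real \<times> real) set" where
  "trop_line l = trop_locus (SOME f. line_equation f l)"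


lemma poly2_eval_affine:
  fixes f :: "'k::field poly2"
  assumes "\<forall>w\<in>Poly_Mapping.keys f. fst w + snd w \<le> 1"
  shows "poly2_eval f (x, y) = Poly_Mapping.lookup f (1, 0) * x +
           Poly_Mapping.lookup f (0, 1) * y + Poly_Mapping.lookup f (0, 0)"
proof -
  have "Poly_Mapping.keys f \<subseteq> {(1, 0), (0, 1), (0, 0)}"
  proof
    fix w assume "w \<in> Poly_Mapping.keys f"
    with assms have "fst w + snd w \<le> 1"
      by blast
    then show "w \<in> {(1, 0), (0, 1), (0, 0)}"
      by (cases w) auto
  qed
  then have "poly2_eval f (x, y) =
      (\<Sum>w\<in>{(1, 0), (0, 1), (0, 0)}. Poly_Mapping.lookup f w * x ^ fst w * y ^ snd w)"
    unfolding poly2_eval_def fst_conv snd_conv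
    by (intro sum.mono_neutral_left) (auto simp: in_keys_iff)
  then show ?thesis
    by simp
qed

lemma line_equation_exists:
  fixes P Q :: "'k::field \<times> 'k"
  assumes "P \<noteq> Q"
  shows "\<exists>f. line_equation f (line_through P Q)"
proof -
  obtain x1 y1 x2 y2 where PQ: "P = (x1, y1)" "Q = (x2, y2)"
    by (metis surj_pair)
  define A B C where "A = y2 - y1" and "B = x1 - x2" and "C = - (A * x1 + B * y1)"
  define f :: "'k poly2" where "f = Poly_Mapping.single (1, 0) A +
    Poly_Mapping.single (0, 1) B + Poly_Mapping.single (0, 0) C"
  have lookup: "Poly_Mapping.lookup f (1, 0) = A" "Poly_Mapping.lookup f (0, 1) = B"
    "Poly_Mapping.lookup f (0, 0) = C"
    by (simp_all add: f_def lookup_add lookup_single when_def)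
  have AB: "A \<noteq> 0 \<or> B \<noteq> 0"
    using assms by (auto simp: A_def B_def PQ)
  have "w = (1, 0) \<or> w = (0, 1) \<or> w = (0, 0)" if "w \<in> Poly_Mapping.keys f" for w
    using that by (auto simp: in_keys_iff f_def lookup_add lookup_single when_def split: if_splits)
  then have keys: "\<forall>w\<in>Poly_Mapping.keys f. fst w + snd w \<le> 1"
    by fastforce
  have deg: "\<exists>w\<in>Poly_Mapping.keys f. fst w + snd w = 1"
  proof (cases "A = 0")
    case True
    with AB lookup have "(0, 1) \<in> Poly_Mapping.keys f"
      by (simp add: in_keys_iff)
    then show ?thesis
      by force
  next
    case False
    with lookup have "(1, 0) \<in> Poly_Mapping.keys f"
      by (simp add: in_keys_iff)
    then show ?thesis
      by force
  qed
  have "(x, y) \<in> line_through P Q \<longleftrightarrow> poly2_eval f (x, y) = 0" for x y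
  proof
    assume "(x, y) \<in> line_through P Q"
    then obtain s where s: "x = x1 + s * (x2 - x1)" "y = y1 + s * (y2 - y1)"
      by (auto simp: line_through_def PQ)
    show "poly2_eval f (x, y) = 0"
      unfolding poly2_eval_affine[OF keys] lookup s by (simp add: A_def B_def C_def algebra_simps)
  next
    assume "poly2_eval f (x, y) = 0"
    then have eq: "(y2 - y1) * (x - x1) = (x2 - x1) * (y - y1)"
      unfolding poly2_eval_affine[OF keys] lookup by (simp add: A_def B_def C_def algebra_simps)
    show "(x, y) \<in> line_through P Q"
    proof (cases "x2 - x1 = 0")
      case True
      then have y: "y2 - y1 \<noteq> 0"
        using AB by (simp add: A_def B_def)
      with eq True have "x = x1"
        by simp
      with True y show ?thesis
        unfolding line_through_def PQ mem_Collect_eq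
        by (intro exI[of _ "(y - y1) / (y2 - y1)"]) simp
    next
      case False
      have "(x - x1) / (x2 - x1) * (y2 - y1) = y - y1"
        using eq False by (simp add: nonzero_divide_eq_eq mult.commute)
      with False show ?thesis
        unfolding line_through_def PQ mem_Collect_eq
        by (intro exI[of _ "(x - x1) / (x2 - x1)"]) simp
    qed
  qed
  with keys deg have "line_equation f (line_through P Q)"
    unfolding line_equation_def by auto
  then show ?thesis
    by blast
qed

lemma line_equation_unique:
  fixes f g :: "'k::field poly2"
  assumes f: "line_equation f l" and g: "line_equation g l"
  shows "\<exists>c. c \<noteq> 0 \<and> (\<forall>w. Poly_Mapping.lookup g w = c * Poly_Mapping.lookup f w)"
proof -
  have aff: "\<forall>w\<in>Poly_Mapping.keys f. fst w + snd w \<le> 1" "\<forall>w\<in>Poly_Mapping.keys g. fst w + snd w \<le> 1"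
    using f g by (auto simp: line_equation_def)
  have nontriv: "Poly_Mapping.lookup h (1, 0) \<noteq> 0 \<or> Poly_Mapping.lookup h (0, 1) \<noteq> 0"
    if h: "line_equation h l" for h :: "'k poly2"
  proof -
    from h obtain i j where w: "(i, j) \<in> Poly_Mapping.keys h" "i + j = 1"
      unfolding line_equation_def by fastforce
    then have "(i, j) = (1, 0) \<or> (i, j) = (0, 1)"
      by auto
    with w(1) show ?thesis
      by (auto simp: in_keys_iff)
  qed
  define A B C where "A = Poly_Mapping.lookup f (1, 0)" and "B = Poly_Mapping.lookup f (0, 1)"
    and "C = Poly_Mapping.lookup f (0, 0)"
  define A' B' C' where "A' = Poly_Mapping.lookup g (1, 0)" and "B' = Poly_Mapping.lookup g (0, 1)"
    and "C' = Poly_Mapping.lookup g (0, 0)"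
  have "poly2_eval f (x, y) = 0 \<longleftrightarrow> poly2_eval g (x, y) = 0" for x y
    using f g unfolding line_equation_def by blast
  then have same: "A * x + B * y + C = 0 \<Longrightarrow> A' * x + B' * y + C' = 0" for x y
    by (simp add: poly2_eval_affine[OF aff(1)] poly2_eval_affine[OF aff(2)]
        A_def B_def C_def A'_def B'_def C'_def)
  have AB: "A \<noteq> 0 \<or> B \<noteq> 0" and AB': "A' \<noteq> 0 \<or> B' \<noteq> 0"
    using nontriv[OF f] nontriv[OF g] by (simp_all add: A_def B_def A'_def B'_def)
  have "\<exists>c. c \<noteq> 0 \<and> A' = c * A \<and> B' = c * B \<and> C' = c * C"
  proof (cases "A = 0")
    case False
    have 1: "A' * (- C / A) + C' = 0" and 2: "A' * (- (B + C) / A) + B' + C' = 0"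
      using same[of "- C / A" 0] same[of "- (B + C) / A" 1] False by auto
    have C: "C' = A' / A * C"
      using 1 by (simp add: eq_neg_iff_add_eq_0 add.commute)
    have "(A' * (- (B + C) / A) + B' + C') - (A' * (- C / A) + C') = B' - A' / A * B"
      by (simp add: add_divide_distrib diff_divide_distrib algebra_simps)
    then have B: "B' = A' / A * B"
      by (simp only: 1 2 diff_self) simp
    show ?thesis
      using False AB' B C by (intro exI[of _ "A' / A"]) auto
  next
    case True
    with AB have nz: "B \<noteq> 0"
      by simp
    have 1: "B' * (- C / B) + C' = 0" and 2: "A' + B' * (- C / B) + C' = 0"
      using same[of 0 "- C / B"] same[of 1 "- C / B"] nz True by auto
    have A: "A' = 0"
      using 1 2 by (simp add: add.assoc)
    have C: "C' = B' / B * C"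
      using 1 by (simp add: eq_neg_iff_add_eq_0 add.commute)
    show ?thesis
      using nz True A AB' C by (intro exI[of _ "B' / B"]) auto
  qed
  then obtain c where c: "c \<noteq> 0" "A' = c * A" "B' = c * B" "C' = c * C"
    by blast
  have "Poly_Mapping.lookup g w = c * Poly_Mapping.lookup f w" for w
  proof (cases "fst w + snd w \<le> 1")
    case True
    then have "w = (1, 0) \<or> w = (0, 1) \<or> w = (0, 0)"
      by (cases w) auto
    with c show ?thesis
      by (auto simp: A_def B_def C_def A'_def B'_def C'_def)
  next
    case False
    then have "w \<notin> Poly_Mapping.keys f" "w \<notin> Poly_Mapping.keys g"
      using aff by blast+
    then show ?thesis
      by (simp add: in_keys_iff)
  qed
  with c(1) show ?thesis
    by blast
qed

lemma trop_line_eq: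
  fixes f :: "'a::field puiseux poly2"
  assumes "line_equation f l"
  shows "trop_line l = trop_locus f"
proof -
  define g where "g = (SOME g :: 'a puiseux poly2. line_equation g l)"
  have "line_equation g l"
    unfolding g_def using assms by (rule someI)
  then obtain c where c: "c \<noteq> 0" and
    gc: "\<And>w. Poly_Mapping.lookup g w = c * Poly_Mapping.lookup f w"
    using line_equation_unique[OF assms] by metis
  have nz: "Poly_Mapping.lookup g w \<noteq> 0 \<longleftrightarrow> Poly_Mapping.lookup f w \<noteq> 0" for w
    using c by (simp add: gc)
  let ?k = "of_rat (pval c) :: real"
  have tt: "trop_term g w z = trop_term f w z - ?k" if "Poly_Mapping.lookup f w \<noteq> 0" for w z
    using pval_mult[OF c that] by (simp add: trop_term_def gc of_rat_add)
  have shift: "trop g z = trop f z - ?k" for z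
  proof -
    let ?S = "{trop_term f w z | w. Poly_Mapping.lookup f w \<noteq> 0}"
    have fin: "finite ?S"
      unfolding in_keys_iff[symmetric]
      by (simp only: setcompr_eq_image Collect_mem_eq finite_imageI finite_keys)
    have ne: "?S \<noteq> {}"
      using assms by (auto simp: line_equation_def in_keys_iff)
    have "{trop_term g w z | w. Poly_Mapping.lookup g w \<noteq> 0} = (\<lambda>x. x - ?k) ` ?S"
      unfolding setcompr_eq_image nz image_image by (rule image_cong) (simp_all add: tt)
    then have "trop g z = Max ((\<lambda>x. x - ?k) ` ?S)"
      by (simp only: trop_def)
    also have "\<dots> = Max ?S - ?k"
      by (rule mono_Max_commute[symmetric, OF _ fin ne]) (simp add: mono_def)
    finally show ?thesis
      by (simp add: trop_def)
  qed
  have eq_iff: "trop_term g w z = trop g z \<longleftrightarrow> trop_term f w z = trop f z"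
    if "Poly_Mapping.lookup f w \<noteq> 0" for w z
    using tt[OF that, of z] shift[of z] by linarith
  have "trop_locus g = trop_locus f"
    by (simp add: trop_locus_def nz eq_iff cong: conj_cong)
  then show ?thesis
    by (simp add: trop_line_def g_def)
qed


section \<open>Tropical lines\<close>

definition tropical_ray :: "real \<times> real \<Rightarrow> real \<times> real \<Rightarrow> (real \<times> real) set" where
  "tropical_ray p d = {p + s *\<^sub>R d | s. s \<ge> 0}"

definition tropical_directions :: "(real \<times> real) set" where
  "tropical_directions = {(-1, 0), (0, -1), (1, 1)}"

definition tropical_line_at :: "real \<times> real \<Rightarrow> (real \<times> real) set" where
  "tropical_line_at p = (\<Union>d\<in>tropical_directions. tropical_ray p d)"

definition is_tropical_line :: "(real \<times> real) set \<Rightarrow> bool" where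
  "is_tropical_line L \<longleftrightarrow> (\<exists>p. L = tropical_line_at p)"

definition coaxial :: "real \<times> real \<Rightarrow> real \<times> real \<Rightarrow> bool" where
  "coaxial p q \<longleftrightarrow> (\<exists>c. \<exists>d\<in>tropical_directions. p \<in> tropical_ray c d \<and> q \<in> tropical_ray c d)"

definition tropical_line_through ::
    "real \<times> real \<Rightarrow> real \<times> real \<Rightarrow> (real \<times> real) set \<Rightarrow> bool" where
  "tropical_line_through p q L \<longleftrightarrow> is_tropical_line L \<and> p \<in> L \<and> q \<in> L"

definition stable_tropical_line ::
    "real \<times> real \<Rightarrow> real \<times> real \<Rightarrow> (real \<times> real) set \<Rightarrow> bool" where
  "stable_tropical_line p q L \<longleftrightarrow> tropical_line_through p q L \<and>
     ((\<forall>L'. tropical_line_through p q L' \<longrightarrow> L' = L) \<or>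
      L = tropical_line_at p \<or> L = tropical_line_at q)"

definition rat_point :: "rat \<times> rat \<Rightarrow> real \<times> real" where
  "rat_point p = (of_rat (fst p), of_rat (snd p))"

definition is_lift :: "'a::field puiseux \<times> 'a puiseux \<Rightarrow> rat \<times> rat \<Rightarrow> bool" where
  "is_lift P p \<longleftrightarrow> fst P \<noteq> 0 \<and> snd P \<noteq> 0 \<and> p = (- pval (fst P), - pval (snd P))"

end

theory Submission
  imports Defs
begin

text \<open>
  Both second coordinates have valuation \<open>v\<close>, so \<open>p\<^sub>1\<close> and \<open>p\<^sub>2\<close> lie on a horizontal line and
  differ in their first coordinates; by symmetry let \<open>u < u'\<close>, so that \<open>p\<^sub>1\<close> is the right one.

  Let \<open>A x + B y + C = 0\<close> be an equation of the line through \<open>P\<^sub>1 = (x\<^sub>1, y\<^sub>1)\<close> and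
  \<open>P\<^sub>2 = (x\<^sub>2, y\<^sub>2)\<close>. Eliminating one coefficient at a time from the two incidence relations gives
  \<open>A (x\<^sub>1 - x\<^sub>2) = B (y\<^sub>2 - y\<^sub>1)\<close> and \<open>C (y\<^sub>2 - y\<^sub>1) = A (x\<^sub>2 y\<^sub>1 - x\<^sub>1 y\<^sub>2)\<close>. The valuations of
  \<open>x\<^sub>1 - x\<^sub>2\<close> and \<open>x\<^sub>2 y\<^sub>1 - x\<^sub>1 y\<^sub>2\<close> are \<open>u\<close> and \<open>u + v\<close>, because of the strict inequality
  \<open>u < u'\<close>. The valuation of \<open>y\<^sub>2 - y\<^sub>1\<close> is \<open>v\<close>, because the leading coefficients \<open>b\<^sub>1 \<noteq> b\<^sub>2\<close> do not
  cancel. Hence \<open>val A - val C = -u\<close> and \<open>val B - val C = -v\<close>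
  (\<open>val_line_coefficients\<close>). For a line with three nonzero coefficients these differences are the
  coordinates of the vertex of its tropicalization (\<open>trop_locus_affine\<close>), which is therefore the
  tropical line with vertex \<open>p\<^sub>1\<close>.

  This line passes through \<open>p\<^sub>2\<close>, which lies to the left of \<open>p\<^sub>1\<close>, so it is stable. It is the only
  stable one: the line with vertex \<open>p\<^sub>2\<close> misses \<open>p\<^sub>1\<close>, and a line that is the unique one through both
  points equals the one just found (\<open>stable_tropical_line_horizontal\<close>).
\<close>

section \<open>Valuations of differences\<close>

lemma has_leading_term_pval:
  assumes "has_leading_term f a q"
  shows "pval f = q"
  using assms unfolding has_leading_term_def pval_def
  by (intro Least_equality) (metis, metis not_less)

lemma pval_less_nth_eq_0:
  fixes f :: "'a::field puiseux"
  assumes "f \<noteq> 0" "r < pval f"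
  shows "puiseux_nth f r = 0"
  using puiseux_val(2)[OF assms(1)] assms(2) by (metis not_less)

lemma has_leading_term_nonzero:
  fixes f :: "'a::field puiseux"
  assumes "has_leading_term f a q"
  shows "f \<noteq> 0"
  using assms by (auto simp: has_leading_term_def zero_puiseux.rep_eq)

lemma has_leading_term_diff:
  fixes f g :: "'a::field puiseux"
  assumes "has_leading_term f a q" "has_leading_term g b q" "a \<noteq> b"
  shows "has_leading_term (f - g) (a - b) q"
  using assms by (simp add: has_leading_term_def minus_puiseux.rep_eq)

lemma has_leading_term_diff_dominant:
  fixes f g :: "'a::field puiseux"
  assumes "f \<noteq> 0" "g \<noteq> 0" "pval f < pval g"
  shows "has_leading_term (f - g) (puiseux_nth f (pval f)) (pval f)"
  using assms puiseux_val(1)[OF assms(1)] pval_less_nth_eq_0[OF assms(1)]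
    pval_less_nth_eq_0[OF assms(2)]
  by (simp add: has_leading_term_def minus_puiseux.rep_eq)

lemma pval_diff_dominant:
  fixes f g :: "'a::field puiseux"
  assumes "f \<noteq> 0" "g \<noteq> 0" "pval f < pval g"
  shows "f - g \<noteq> 0" "pval (f - g) = pval f"
    and "g - f \<noteq> 0" "pval (g - f) = pval f"
proof -
  have "has_leading_term (f - g) (puiseux_nth f (pval f)) (pval f)"
    using assms by (rule has_leading_term_diff_dominant)
  moreover from this have "has_leading_term (g - f) (- puiseux_nth f (pval f)) (pval f)"
    by (simp add: has_leading_term_def minus_puiseux.rep_eq)
  ultimately show "f - g \<noteq> 0" "pval (f - g) = pval f" "g - f \<noteq> 0" "pval (g - f) = pval f"
    using has_leading_term_nonzero has_leading_term_pval by blast+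
qed


section \<open>The tropicalization of a line with three nonzero coefficients\<close>

lemma mem_tropical_line_at_iff:
  "(x, y) \<in> tropical_line_at (c, d) \<longleftrightarrow>
     (y = d \<and> x \<le> c) \<or> (x = c \<and> y \<le> d) \<or> (x - c = y - d \<and> x \<ge> c)"
proof -
  have "(x, y) \<in> tropical_ray (c, d) (-1, 0) \<longleftrightarrow> y = d \<and> x \<le> c"
    unfolding tropical_ray_def by (auto intro: exI[of _ "c - x"])
  moreover have "(x, y) \<in> tropical_ray (c, d) (0, -1) \<longleftrightarrow> x = c \<and> y \<le> d"
    unfolding tropical_ray_def by (auto intro: exI[of _ "d - y"])
  moreover have "(x, y) \<in> tropical_ray (c, d) (1, 1) \<longleftrightarrow> x - c = y - d \<and> x \<ge> c"
    unfolding tropical_ray_def by (auto intro: exI[of _ "x - c"])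
  ultimately show ?thesis
    by (simp add: tropical_line_at_def tropical_directions_def)
qed

text \<open>
  At the point \<open>(\<alpha> - \<gamma>, \<beta> - \<gamma>)\<close>, where \<open>\<alpha>\<close>, \<open>\<beta>\<close>, \<open>\<gamma>\<close> are the valuations of the coefficients of
  \<open>x\<close>, \<open>y\<close>, \<open>1\<close>, all three terms of the tropical polynomial agree. On each ray from there two of them
  stay equal while the third falls below them; off the rays a single term is the largest.
\<close>

lemma trop_locus_affine:
  fixes f :: "'a::field puiseux poly2"
  assumes aff: "\<forall>w\<in>Poly_Mapping.keys f. fst w + snd w \<le> 1"
    and A: "Poly_Mapping.lookup f (1, 0) \<noteq> 0"
    and B: "Poly_Mapping.lookup f (0, 1) \<noteq> 0"
    and C: "Poly_Mapping.lookup f (0, 0) \<noteq> 0"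
  shows "trop_locus f = tropical_line_at
    (of_rat (pval (Poly_Mapping.lookup f (1, 0)) - pval (Poly_Mapping.lookup f (0, 0))),
     of_rat (pval (Poly_Mapping.lookup f (0, 1)) - pval (Poly_Mapping.lookup f (0, 0))))"
proof -
  let ?\<alpha> = "of_rat (pval (Poly_Mapping.lookup f (1, 0))) :: real"
  let ?\<beta> = "of_rat (pval (Poly_Mapping.lookup f (0, 1))) :: real"
  let ?\<gamma> = "of_rat (pval (Poly_Mapping.lookup f (0, 0))) :: real"
  have supp: "Poly_Mapping.lookup f w \<noteq> 0 \<longleftrightarrow> w = (1, 0) \<or> w = (0, 1) \<or> w = (0, 0)" for w
  proof
    assume "Poly_Mapping.lookup f w \<noteq> 0"
    with aff have "fst w + snd w \<le> 1"
      by (simp add: in_keys_iff)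
    then show "w = (1, 0) \<or> w = (0, 1) \<or> w = (0, 0)"
      by (cases w) auto
  qed (use A B C in auto)
  have tt: "trop_term f (1, 0) (x, y) = x - ?\<alpha>" "trop_term f (0, 1) (x, y) = y - ?\<beta>"
    "trop_term f (0, 0) (x, y) = - ?\<gamma>" for x y
    by (simp_all add: trop_term_def)
  have "(x, y) \<in> trop_locus f \<longleftrightarrow> (x, y) \<in> tropical_line_at (?\<alpha> - ?\<gamma>, ?\<beta> - ?\<gamma>)" for x y
  proof -
    have "{trop_term f w (x, y) | w. Poly_Mapping.lookup f w \<noteq> 0} =
        (\<lambda>w. trop_term f w (x, y)) ` {(1, 0), (0, 1), (0, 0)}"
      unfolding supp by blast
    also have "\<dots> = {x - ?\<alpha>, y - ?\<beta>, - ?\<gamma>}"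
      by (simp only: image_insert image_empty tt)
    finally have "{trop_term f w (x, y) | w. Poly_Mapping.lookup f w \<noteq> 0} =
        {x - ?\<alpha>, y - ?\<beta>, - ?\<gamma>}" .
    then have trop: "trop f (x, y) = max (x - ?\<alpha>) (max (y - ?\<beta>) (- ?\<gamma>))"
      by (simp add: trop_def)
    let ?M = "\<lambda>w. trop_term f w (x, y) = trop f (x, y)"
    have "(x, y) \<in> trop_locus f \<longleftrightarrow>
        (?M (1, 0) \<and> ?M (0, 1)) \<or> (?M (1, 0) \<and> ?M (0, 0)) \<or> (?M (0, 1) \<and> ?M (0, 0))"
    proof
      assume "(x, y) \<in> trop_locus f"
      then show "(?M (1, 0) \<and> ?M (0, 1)) \<or> (?M (1, 0) \<and> ?M (0, 0)) \<or> (?M (0, 1) \<and> ?M (0, 0))"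
        unfolding trop_locus_def supp mem_Collect_eq by metis
    next
      assume *: "(?M (1, 0) \<and> ?M (0, 1)) \<or> (?M (1, 0) \<and> ?M (0, 0)) \<or> (?M (0, 1) \<and> ?M (0, 0))"
      have "(1::nat, 0::nat) \<noteq> (0, 1)" "(1::nat, 0::nat) \<noteq> (0, 0)" "(0::nat, 1::nat) \<noteq> (0, 0)"
        by simp_all
      with * show "(x, y) \<in> trop_locus f"
        unfolding trop_locus_def supp mem_Collect_eq by metis
    qed
    also have "\<dots> \<longleftrightarrow> (x, y) \<in> tropical_line_at (?\<alpha> - ?\<gamma>, ?\<beta> - ?\<gamma>)"
      unfolding mem_tropical_line_at_iff trop tt max_def by auto
    finally show ?thesis .
  qed
  then have "z \<in> trop_locus f \<longleftrightarrow> z \<in> tropical_line_at (?\<alpha> - ?\<gamma>, ?\<beta> - ?\<gamma>)" for z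
    by (cases z) simp
  then show ?thesis
    by (auto simp: of_rat_diff)
qed


section \<open>The line through two points with aligned tropicalizations\<close>

text \<open>
  The two differences at the end are the coordinates of the vertex. The hypothesis that
  \<open>pval (y2 - y1) = v\<close> excludes a cancellation of leading terms: an excess of the valuation of
  \<open>y2 - y1\<close> over \<open>v\<close> would move the vertex to the right by that excess.
\<close>

lemma val_line_coefficients:
  fixes A B C x1 y1 x2 y2 :: "'a::field puiseux"
  assumes inc1: "A * x1 + B * y1 + C = 0" and inc2: "A * x2 + B * y2 + C = 0"
    and AB: "A \<noteq> 0 \<or> B \<noteq> 0"
    and nz: "x1 \<noteq> 0" "x2 \<noteq> 0" "y1 \<noteq> 0" "y2 \<noteq> 0"
    and x: "pval x1 < pval x2"
    and y: "pval y1 = v" "pval y2 = v" "y2 - y1 \<noteq> 0" "pval (y2 - y1) = v"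
  shows "A \<noteq> 0" "B \<noteq> 0" "C \<noteq> 0" "pval A - pval C = - pval x1" "pval B - pval C = - v"
proof -
  have dx: "x1 - x2 \<noteq> 0" "pval (x1 - x2) = pval x1"
    using pval_diff_dominant[OF nz(1,2) x] by simp_all
  have "pval (x1 * y2) < pval (x2 * y1)"
    using nz x y by (simp add: pval_mult)
  then have det: "x2 * y1 - x1 * y2 \<noteq> 0" "pval (x2 * y1 - x1 * y2) = pval x1 + v"
    using pval_diff_dominant(3,4)[of "x1 * y2" "x2 * y1"] nz y by (simp_all add: pval_mult)
  have elim_C: "A * (x1 - x2) = B * (y2 - y1)"
  proof -
    have "A * (x1 - x2) - B * (y2 - y1) = (A * x1 + B * y1 + C) - (A * x2 + B * y2 + C)"
      by (simp add: algebra_simps)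
    then show ?thesis
      by (simp add: inc1 inc2)
  qed
  have elim_B: "C * (y2 - y1) = A * (x2 * y1 - x1 * y2)"
  proof -
    have "C * (y2 - y1) - A * (x2 * y1 - x1 * y2) =
        (A * x1 + B * y1 + C) * y2 - (A * x2 + B * y2 + C) * y1"
      by (simp add: algebra_simps)
    then show ?thesis
      by (simp add: inc1 inc2)
  qed
  show A: "A \<noteq> 0"
    using elim_C AB y(3) by auto
  show B: "B \<noteq> 0"
    using elim_C A dx(1) by auto
  show C: "C \<noteq> 0"
    using elim_B A det(1) by auto
  have "pval A + pval x1 = pval B + v"
    using arg_cong[OF elim_C, of pval] pval_mult[OF A dx(1)] pval_mult[OF B y(3)] dx(2) y(4)
    by simp
  moreover have "pval C + v = pval A + (pval x1 + v)"
    using arg_cong[OF elim_B, of pval] pval_mult[OF C y(3)] pval_mult[OF A det(1)] det(2) y(4)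
    by simp
  ultimately show "pval A - pval C = - pval x1" "pval B - pval C = - v"
    by linarith+
qed

lemma line_through_contains: "P \<in> line_through P Q" "Q \<in> line_through P Q"
  unfolding line_through_def by (force intro: exI[of _ 0], force intro: exI[of _ 1])

lemma line_equation_nontrivial:
  assumes "line_equation f l"
  shows "Poly_Mapping.lookup f (1, 0) \<noteq> 0 \<or> Poly_Mapping.lookup f (0, 1) \<noteq> 0"
proof -
  from assms obtain i j where w: "(i, j) \<in> Poly_Mapping.keys f" "i + j = 1"
    unfolding line_equation_def by fastforce
  then have "(i, j) = (1, 0) \<or> (i, j) = (0, 1)"
    by auto
  with w(1) show ?thesis
    by (auto simp: in_keys_iff)
qed

lemma trop_line_through_horizontal:
  fixes P1 P2 :: "'a::field puiseux \<times> 'a puiseux"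
  assumes lifts: "is_lift P1 (- u, - v)" "is_lift P2 (- u', - v)"
    and lt: "has_leading_term (snd P1) b1 v" "has_leading_term (snd P2) b2 v"
    and b: "b1 \<noteq> b2" and u: "u < u'"
  shows "trop_line (line_through P1 P2) = tropical_line_at (rat_point (- u, - v))"
proof -
  have nz: "fst P1 \<noteq> 0" "fst P2 \<noteq> 0" "snd P1 \<noteq> 0" "snd P2 \<noteq> 0"
    and val: "pval (fst P1) = u" "pval (fst P2) = u'" "pval (snd P1) = v" "pval (snd P2) = v"
    using lifts by (simp_all add: is_lift_def)
  have "has_leading_term (snd P2 - snd P1) (b2 - b1) v"
    using lt b by (intro has_leading_term_diff) auto
  then have dy: "snd P2 - snd P1 \<noteq> 0" "pval (snd P2 - snd P1) = v"
    using has_leading_term_nonzero has_leading_term_pval by blast+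
  then have "P1 \<noteq> P2"
    by auto
  then obtain f where f: "line_equation f (line_through P1 P2)"
    using line_equation_exists by blast
  then have aff: "\<forall>w\<in>Poly_Mapping.keys f. fst w + snd w \<le> 1"
    by (simp add: line_equation_def)
  have "poly2_eval f (fst P1, snd P1) = 0" "poly2_eval f (fst P2, snd P2) = 0"
    using f line_through_contains[of P1 P2] line_through_contains[of P2 P1]
    by (auto simp: line_equation_def)
  note inc = this[unfolded poly2_eval_affine[OF aff]]
  note coeff = val_line_coefficients[OF inc line_equation_nontrivial[OF f] nz _ val(3,4) dy,
      unfolded val, OF u]
  show ?thesis
    unfolding trop_line_eq[OF f] trop_locus_affine[OF aff coeff(1-3)] coeff(4,5)
    by (simp add: rat_point_def)
qed


section \<open>The stable line through two points on a horizontal line\<close>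

text \<open>
  Sliding the vertex to the right of \<open>(x, y)\<close> gives further lines through both points; stability
  selects the one among them whose vertex is as far to the left as possible.
\<close>

lemma stable_tropical_line_horizontal:
  assumes "x' < x"
  shows "stable_tropical_line (x, y) (x', y) L \<longleftrightarrow> L = tropical_line_at (x, y)"
proof
  have through: "tropical_line_through (x, y) (x', y) (tropical_line_at (x, y))"
    using assms by (auto simp: tropical_line_through_def is_tropical_line_def mem_tropical_line_at_iff)
  show "stable_tropical_line (x, y) (x', y) L" if "L = tropical_line_at (x, y)"
    using through that by (simp add: stable_tropical_line_def)
  show "L = tropical_line_at (x, y)" if L: "stable_tropical_line (x, y) (x', y) L"
  proof -
    have "(x, y) \<in> L"
      using L by (simp add: stable_tropical_line_def tropical_line_through_def)
    moreover have "(x, y) \<notin> tropical_line_at (x', y)"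
      using assms by (simp add: mem_tropical_line_at_iff)
    ultimately have "L \<noteq> tropical_line_at (x', y)"
      by blast
    with L through show ?thesis
      unfolding stable_tropical_line_def by blast
  qed
qed

lemma line_through_commute_subset: "line_through P Q \<subseteq> line_through Q P"
proof
  fix X assume "X \<in> line_through P Q"
  then obtain s where
    "X = (fst P + s * (fst Q - fst P), snd P + s * (snd Q - snd P))"
    by (auto simp: line_through_def)
  then show "X \<in> line_through Q P"
    unfolding line_through_def mem_Collect_eq
    by (intro exI[of _ "1 - s"]) (simp add: algebra_simps)
qed

lemma line_through_commute: "line_through P Q = line_through Q P"
  using line_through_commute_subset by blast

lemma stable_tropical_line_commute:
  "stable_tropical_line p q L \<longleftrightarrow> stable_tropical_line q p L"
  by (auto simp: stable_tropical_line_def tropical_line_through_def)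

lemma stable_iff_trop_line:
  fixes P1 P2 :: "'a::field puiseux \<times> 'a puiseux"
  assumes "is_lift P1 (- u, - v)" "is_lift P2 (- u', - v)"
    and "has_leading_term (snd P1) b1 v" "has_leading_term (snd P2) b2 v"
    and "b1 \<noteq> b2" and "u < u'"
  shows "stable_tropical_line (rat_point (- u, - v)) (rat_point (- u', - v)) L \<longleftrightarrow>
    L = trop_line (line_through P1 P2)"
  using trop_line_through_horizontal[OF assms] stable_tropical_line_horizontal assms(6)
  by (simp add: rat_point_def of_rat_less)

theorem proposition1:
  fixes u v u' v' :: rat
    and p1 p2 :: "rat \<times> rat"
    and P1 P2 :: "'a::field puiseux \<times> 'a puiseux"
    and a1 b1 a2 b2 :: 'a
  assumes "p1 = (- u, - v)" and "p2 = (- u', - v')"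
    and "p1 \<noteq> p2"
    and "coaxial (rat_point p1) (rat_point p2)"
    and "is_lift P1 p1"
    and "has_leading_term (fst P1) a1 u" and "has_leading_term (snd P1) b1 v"
    and "is_lift P2 p2"
    and "has_leading_term (fst P2) a2 u'" and "has_leading_term (snd P2) b2 v"
    and "b1 \<noteq> b2"
  shows "stable_tropical_line (rat_point p1) (rat_point p2) (trop_line (line_through P1 P2)) \<and>
    (\<forall>L. stable_tropical_line (rat_point p1) (rat_point p2) L \<longrightarrow>
         L = trop_line (line_through P1 P2))"
proof -
  have v': "v' = v"
    using assms(2,8,10) has_leading_term_pval by (fastforce simp: is_lift_def)
  have lifts: "is_lift P1 (- u, - v)" "is_lift P2 (- u', - v)"
    using assms(1,2,5,8) v' by simp_all
  have "u \<noteq> u'"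
    using assms(1-3) v' by auto
  then consider "u < u'" | "u' < u"
    by linarith
  then have "stable_tropical_line (rat_point p1) (rat_point p2) L \<longleftrightarrow>
      L = trop_line (line_through P1 P2)" for L
  proof cases
    case 1
    then show ?thesis
      using stable_iff_trop_line[OF lifts assms(7,10,11)] assms(1,2) v' by simp
  next
    case 2
    then show ?thesis
      using stable_iff_trop_line[OF lifts(2,1) assms(10,7) assms(11)[symmetric]] assms(1,2) v'
        stable_tropical_line_commute[of "rat_point p1"] line_through_commute[of P1]
      by simp
  qed
  then show ?thesis
    by simp
qed

end
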